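(* Let $s\ge 1$ and $g,h\ge 2$ be integers, and let $R$ (red) and $B$ (blue) be finite point sets in the plane with $R\cup B$ in general position and with pairwise distinct $x$-coordinates, where $|R|=(s+1)g+sh$ and $|B|=sg+(s+1)h$. For each $i=1,\dots,|R|$ fix a vertical line $\ell_i$ through no point of $R\cup B$ such that exactly $i$ red points have $x$-coordinate smaller than that of $\ell_i$, and let $L_i$ be the number of blue points with $x$-coordinate smaller than that of $\ell_i$. For integers $0\le g'\le g$, $0\le h'\le h$ with $(g',h')\ne(0,0)$, put $i=(s+1)g'+sh'$ and define $\operatorname{sg}(g',h')$ to be $-$, $0$ or $+$ according as $L_i<sg'+(s+1)h'$, $L_i=sg'+(s+1)h'$, or $L_i>sg'+(s+1)h'$. Assume that $\operatorname{sg}(g',h')\neq 0$ for all such $(g',h')$ and that $\operatorname{sg}(1,0)=-$. Then there exist either two pairs $(g_1,h_1),(g_3,h_3)$ with $g_1+g_3=g$ and $h_1+h_3=h$, or three pairs $(g_1,h_1),(g_2,h_2),(g_3,h_3)$ with $g_1+g_2+g_3=g$ and $h_1+h_2+h_3=h$ (all pairs of nonnegative integers, none equal to $(0,0)$), such that all these pairs have the same sign $\operatorname{sg}$, and either $g_i \le \lfloor \frac{2g}{3}\rfloor$ for all of the pairs or $h_i \le \lfloor \frac{2h}{3}\rfloor$ for all of the pairs.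
   Context: General position: no three points collinear. *)

theory Defs
  imports "HOL-Analysis.Analysis"
begin

definition general_position :: "(real \<times> real) set \<Rightarrow> bool" where
  "general_position S \<longleftrightarrow>
     (\<forall>p\<in>S. \<forall>q\<in>S. \<forall>r\<in>S. p \<noteq> q \<and> q \<noteq> r \<and> p \<noteq> r \<longrightarrow> \<not> collinear {p, q, r})"

definition vertical_line :: "real \<Rightarrow> (real \<times> real) set" where
  "vertical_line c = {p. fst p = c}"

definition num_left :: "(real \<times> real) set \<Rightarrow> real \<Rightarrow> nat" where
  "num_left S c = card {p \<in> S. fst p < c}"

text \<open>
  The family \<open>l\<close> gives the abscissae of the vertical lines, so the number of blue points
  to the left of the \<open>i\<close>-th line is \<open>num_left B (l i)\<close>.  The signs
  minus, zero, plus are the values \<open>-1, 0, 1\<close> of \<^const>\<open>sgn\<close> on integers.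
\<close>

definition sg :: "nat \<Rightarrow> (real \<times> real) set \<Rightarrow> (nat \<Rightarrow> real) \<Rightarrow> nat \<Rightarrow> nat \<Rightarrow> int" where
  "sg s B l g' h' =
     sgn (int (num_left B (l ((s + 1) * g' + s * h'))) - int (s * g' + (s + 1) * h'))"

end

theory Submission
  imports Defs
begin

text \<open>
  Suppose no such pairs or triples exist and let \<open>c = (g, h)\<close>.  Monotonicity of the blue count gives
  \<open>sg (0, 1) = -1\<close> besides \<open>sg (1, 0) = -1\<close>.  As long as one of the two bounds holds, \<open>p\<close> and \<open>c - p\<close>
  have opposite signs (no pair), and if \<open>p\<close> is negative then so is \<open>p + e\<close> for \<open>e\<close> either unit
  vector: otherwise \<open>p, e, c - p - e\<close> is a negative triple.  So a negative \<open>p \<le> c / 2\<close> with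
  first coordinate at least \<open>g / 3\<close> would propagate up to \<open>c - p\<close>, making \<open>p, c - p\<close> a negative
  pair; hence all these \<open>p\<close> are positive, and likewise for the second coordinate.  Three of them
  add up to \<open>c\<close>.
\<close>

lemma num_left_mono:
  assumes "finite S" "c \<le> d"
  shows "num_left S c \<le> num_left S d"
  unfolding num_left_def using assms by (intro card_mono) auto

text \<open>The sign at \<open>(1, 0)\<close> says that fewer than \<open>s\<close> blue points lie
  left of \<open>l (s + 1)\<close>. The red counts put \<open>l s\<close> no further right, so fewer
  than \<open>s + 1\<close> blue points lie left of it.\<close>

lemma sg_0_1_if_sg_1_0:
  assumes "finite R" "finite B"
    and "num_left R (l s) < num_left R (l (s + 1))"
    and "sg s B l 1 0 = -1"
  shows "sg s B l 0 1 = -1"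
proof -
  have "l s \<le> l (s + 1)"
    using num_left_mono[OF assms(1), of "l (s + 1)" "l s"] assms(3) by linarith
  then have "num_left B (l s) \<le> num_left B (l (s + 1))"
    by (rule num_left_mono[OF assms(2)])
  with assms(4) show ?thesis
    by (auto simp: sg_def sgn_if split: if_splits)
qed

text \<open>A negative \<open>(x, y)\<close> would spread along a lattice path to its complement
  \<open>(g - x, h - y)\<close>, against \<open>no_pair\<close>. The sign function is abstract so
  that the lemma also serves with the coordinates exchanged; \<open>M\<close> will be the floor of
  two thirds of \<open>g\<close>, and only first coordinates are bounded by it.\<close>

lemma negative_propagates:
  fixes S :: "nat \<Rightarrow> nat \<Rightarrow> int"
  assumes sign: "\<And>x y. x \<le> g \<Longrightarrow> y \<le> h \<Longrightarrow> (x, y) \<noteq> (0, 0) \<Longrightarrow> S x y = 1 \<or> S x y = -1"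
    and unit: "S 1 0 = -1" "S 0 1 = -1"
    and M: "1 \<le> M" "M < g"
    and no_pair: "\<And>x1 y1 x2 y2. x1 + x2 = g \<Longrightarrow> y1 + y2 = h \<Longrightarrow>
      (x1, y1) \<noteq> (0, 0) \<Longrightarrow> (x2, y2) \<noteq> (0, 0) \<Longrightarrow> x1 \<le> M \<Longrightarrow> x2 \<le> M \<Longrightarrow> S x1 y1 \<noteq> S x2 y2"
    and no_triple: "\<And>x1 y1 x2 y2 x3 y3. x1 + x2 + x3 = g \<Longrightarrow> y1 + y2 + y3 = h \<Longrightarrow>
      (x1, y1) \<noteq> (0, 0) \<Longrightarrow> (x2, y2) \<noteq> (0, 0) \<Longrightarrow> (x3, y3) \<noteq> (0, 0) \<Longrightarrow>
      x1 \<le> M \<Longrightarrow> x2 \<le> M \<Longrightarrow> x3 \<le> M \<Longrightarrow> \<not> (S x1 y1 = S x2 y2 \<and> S x2 y2 = S x3 y3)"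
    and x: "g - M \<le> x" "2 * x \<le> g" and y: "2 * y \<le> h"
  shows "S x y = 1"
proof (rule ccontr)
  assume "S x y \<noteq> 1"
  moreover have "1 \<le> x"
    using x M by linarith
  ultimately have neg: "S x y = -1"
    using sign[of x y] x y M by auto
  \<comment> \<open>The bounds on \<open>u\<close> keep \<open>u\<close>, \<open>u + d\<close> and
    \<open>g - (u + d)\<close> at most \<open>g - x \<le> M\<close>, so the pair and the triple used
    here are admissible.\<close>
  have step: "S (u + d) (v + e) = -1"
    if "S u v = -1" "(d, e) = (1, 0) \<or> (d, e) = (0, 1)" "x \<le> u" "u + d + x \<le> g" "v + e \<le> h"
    for u v d e
  proof (rule ccontr)
    assume "S (u + d) (v + e) \<noteq> -1"
    moreover have "S (u + d) (v + e) \<noteq> S (g - (u + d)) (h - (v + e))"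
      using that x M by (intro no_pair) auto
    moreover have "0 < g - (u + d)"
      using that(4) x M by linarith
    ultimately have "S (g - (u + d)) (h - (v + e)) = -1"
      using sign[of "u + d" "v + e"] sign[of "g - (u + d)" "h - (v + e)"] that x M by auto
    moreover have "S d e = -1"
      using that(2) unit by auto
    moreover have "\<not> (S u v = S d e \<and> S d e = S (g - (u + d)) (h - (v + e)))"
      using that x M by (intro no_triple) auto
    ultimately show False
      using that(1) by simp
  qed
  \<comment> \<open>The path runs first horizontally to \<open>(g - x, y)\<close>, then vertically
    to \<open>(g - x, h - y)\<close>.\<close>
  have right: "x + k + x \<le> g \<Longrightarrow> S (x + k) y = -1" for k
  proof (induction k)
    case (Suc k)
    then show ?case
      using step[of "x + k" y 1 0] y by simp
  qed (use neg in simp)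
  have up: "y + k \<le> h \<Longrightarrow> S (g - x) (y + k) = -1" for k
  proof (induction k)
    case 0
    then show ?case
      using right[of "g - x - x"] x by simp
  next
    case (Suc k)
    then show ?case
      using step[of "g - x" "y + k" 0 1] x by simp
  qed
  have "S (g - x) (h - y) = -1"
    using up[of "h - y - y"] y by simp
  moreover have "S x y \<noteq> S (g - x) (h - y)"
    using x y M by (intro no_pair) auto
  ultimately show False
    using neg by simp
qed

theorem theorem21:
  fixes s g h :: nat
    and R B :: "(real \<times> real) set"
    and l :: "nat \<Rightarrow> real"
  assumes "s \<ge> 1" and "g \<ge> 2" and "h \<ge> 2"
    and "finite R" and "finite B"
    and "general_position (R \<union> B)"
    and "inj_on fst (R \<union> B)"
    and "card R = (s + 1) * g + s * h"
    and "card B = s * g + (s + 1) * h"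
    and "\<And>i. i \<in> {1..card R} \<Longrightarrow> vertical_line (l i) \<inter> (R \<union> B) = {}"
    and "\<And>i. i \<in> {1..card R} \<Longrightarrow> num_left R (l i) = i"
    and "\<And>g' h'. g' \<le> g \<Longrightarrow> h' \<le> h \<Longrightarrow> (g', h') \<noteq> (0, 0) \<Longrightarrow> sg s B l g' h' \<noteq> 0"
    and "sg s B l 1 0 = -1"
  shows
    "(\<exists>g1 h1 g3 h3.
        g1 + g3 = g \<and> h1 + h3 = h \<and>
        (g1, h1) \<noteq> (0, 0) \<and> (g3, h3) \<noteq> (0, 0) \<and>
        sg s B l g1 h1 = sg s B l g3 h3 \<and>
        ((g1 \<le> 2 * g div 3 \<and> g3 \<le> 2 * g div 3) \<or>
         (h1 \<le> 2 * h div 3 \<and> h3 \<le> 2 * h div 3)))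
     \<or>
     (\<exists>g1 h1 g2 h2 g3 h3.
        g1 + g2 + g3 = g \<and> h1 + h2 + h3 = h \<and>
        (g1, h1) \<noteq> (0, 0) \<and> (g2, h2) \<noteq> (0, 0) \<and> (g3, h3) \<noteq> (0, 0) \<and>
        sg s B l g1 h1 = sg s B l g2 h2 \<and> sg s B l g2 h2 = sg s B l g3 h3 \<and>
        ((g1 \<le> 2 * g div 3 \<and> g2 \<le> 2 * g div 3 \<and> g3 \<le> 2 * g div 3) \<or>
         (h1 \<le> 2 * h div 3 \<and> h2 \<le> 2 * h div 3 \<and> h3 \<le> 2 * h div 3)))"
proof (rule ccontr)
  assume contra: "\<not> ?thesis"
  define S where "S = sg s B l"
  have sign: "S x y = 1 \<or> S x y = -1" if "x \<le> g" "y \<le> h" "(x, y) \<noteq> (0, 0)" for x y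
    using assms(12)[OF that] by (auto simp: S_def sg_def sgn_if split: if_splits)
  \<comment> \<open>This puts the indices \<open>s\<close> and \<open>s + 1\<close> in the range
    where the red counts are prescribed.\<close>
  have "s + 1 \<le> card R"
    using assms(2,8) mult_le_mono2[of 1 g "s + 1"] by simp
  then have unit: "S 1 0 = -1" "S 0 1 = -1"
    using assms(1,11,13) sg_0_1_if_sg_1_0[OF assms(4,5)] by (auto simp: S_def)
  have no_pair: "S x1 y1 \<noteq> S x2 y2"
    if "x1 + x2 = g" "y1 + y2 = h" "(x1, y1) \<noteq> (0, 0)" "(x2, y2) \<noteq> (0, 0)"
      "x1 \<le> 2 * g div 3 \<and> x2 \<le> 2 * g div 3 \<or> y1 \<le> 2 * h div 3 \<and> y2 \<le> 2 * h div 3"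
    for x1 y1 x2 y2
    using contra that unfolding S_def by blast
  have no_triple: "\<not> (S x1 y1 = S x2 y2 \<and> S x2 y2 = S x3 y3)"
    if "x1 + x2 + x3 = g" "y1 + y2 + y3 = h"
      "(x1, y1) \<noteq> (0, 0)" "(x2, y2) \<noteq> (0, 0)" "(x3, y3) \<noteq> (0, 0)"
      "x1 \<le> 2 * g div 3 \<and> x2 \<le> 2 * g div 3 \<and> x3 \<le> 2 * g div 3 \<or>
       y1 \<le> 2 * h div 3 \<and> y2 \<le> 2 * h div 3 \<and> y3 \<le> 2 * h div 3"
    for x1 y1 x2 y2 x3 y3
    using contra that unfolding S_def by blast
  have pos_g: "S x y = 1" if "g - 2 * g div 3 \<le> x" "2 * x \<le> g" "2 * y \<le> h" for x y
  proof (rule negative_propagates[where S = S and g = g and h = h and M = "2 * g div 3"])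
    show "1 \<le> 2 * g div 3" "2 * g div 3 < g"
      using assms(2) by linarith+
  qed (use sign unit no_pair no_triple that in \<open>simp_all; fail\<close>)+
  have pos_h: "S x y = 1" if "h - 2 * h div 3 \<le> y" "2 * y \<le> h" "2 * x \<le> g" for x y
  proof (rule negative_propagates[where S = "\<lambda>y x. S x y" and g = h and h = g and M = "2 * h div 3"])
    show "1 \<le> 2 * h div 3" "2 * h div 3 < h"
      using assms(3) by linarith+
    show "S x1 y1 \<noteq> S x2 y2"
      if "y1 + y2 = h" "x1 + x2 = g" "(y1, x1) \<noteq> (0, 0)" "(y2, x2) \<noteq> (0, 0)"
        "y1 \<le> 2 * h div 3" "y2 \<le> 2 * h div 3" for y1 x1 y2 x2
      using that by (intro no_pair) auto
    show "\<not> (S x1 y1 = S x2 y2 \<and> S x2 y2 = S x3 y3)"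
      if "y1 + y2 + y3 = h" "x1 + x2 + x3 = g"
        "(y1, x1) \<noteq> (0, 0)" "(y2, x2) \<noteq> (0, 0)" "(y3, x3) \<noteq> (0, 0)"
        "y1 \<le> 2 * h div 3" "y2 \<le> 2 * h div 3" "y3 \<le> 2 * h div 3" for y1 x1 y2 x2 y3 x3
      using that by (intro no_triple) auto
  qed (use sign unit that in auto)
  \<comment> \<open>These are \<open>g / 3\<close> and \<open>h / 3\<close> rounded up, the least
    coordinates that \<open>pos_g\<close> and \<open>pos_h\<close> admit.\<close>
  define a b where "a = g - 2 * g div 3" and "b = h - 2 * h div 3"
  have a: "1 \<le> a" "2 * a \<le> g" "g \<le> 3 * a" "a \<le> 2 * g div 3"
    and b: "1 \<le> b" "2 * b \<le> h" "h \<le> 3 * b"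
    using assms(2,3) unfolding a_def b_def by linarith+
  \<comment> \<open>The triple is \<open>(a, b)\<close>, \<open>(a, h - 2 * b)\<close>,
    \<open>(g - 2 * a, b)\<close>. Since \<open>g - 2 * a\<close> may be less than \<open>a\<close>,
    the last pair is handled through its second coordinate.\<close>
  have "S a b = 1" "S a (h - 2 * b) = 1"
    using a b by (auto intro!: pos_g simp: a_def[symmetric])
  moreover have "S (g - 2 * a) b = 1"
    using a b by (auto intro!: pos_h simp: b_def[symmetric])
  moreover have "\<not> (S a b = S a (h - 2 * b) \<and> S a (h - 2 * b) = S (g - 2 * a) b)"
    using a b by (intro no_triple) auto
  ultimately show False
    by simp
qed

end
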